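(* Let $(B,g_B)$ be an oriented and compact $n$-dimensional Riemannian manifold of constant scalar curvature, with Ricci tensor $S_B$, let $f$ be a smooth function on $B$, and let $m>1$, $\lambda$, $\mu$ be real constants satisfying $$S_B+\operatorname{Hess}(f)+\lambda g_B+\mu\,df\otimes df=0.$$ Let $(F,g_F)$ be an $m$-dimensional Einstein manifold with Ricci tensor $S_F=-\lambda g_F$. Let $\pi:B\times F\to B$ and $\sigma:B\times F\to F$ be the projections, $g:=\pi^*g_B+\sigma^*g_F$ the product metric, $\widetilde f:=f\circ\pi$, $\xi:=\operatorname{grad}(\widetilde f)$, and $\eta$ the $g$-dual $1$-form of $\xi$. If $(g,\xi,\lambda,\mu)$ is a gradient $\eta$-Ricci soliton on the product manifold $(B\times F,g)$, then the scalar curvature of $(B\times F,g)$ is $\geq-(n+m)\lambda$.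
   Context: A tuple $(g,\xi,\lambda,\mu)$ with $\xi$ the gradient of a smooth function, $\eta$ the $g$-dual $1$-form of $\xi$ and $\lambda,\mu$ real constants is a gradient $\eta$-Ricci soliton if $\mathcal{L}_{\xi}g+2S+2\lambda g+2\mu\,\eta\otimes\eta=0$, where $S$ is the Ricci tensor of $g$ and $\mathcal{L}_\xi$ the Lie derivative along $\xi$. $\operatorname{Hess}(f)$ is the Hessian with respect to $g_B$. *)

theory Defs
  imports "HOL-Analysis.Analysis"
begin

section \<open>Smooth maps between Euclidean spaces\<close>

primrec C_k_on :: "nat \<Rightarrow> 'a::euclidean_space set \<Rightarrow> ('a \<Rightarrow> 'b::real_normed_vector) \<Rightarrow> bool" where
  "C_k_on 0 S f \<longleftrightarrow> continuous_on S f"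
| "C_k_on (Suc k) S f \<longleftrightarrow>
     (\<forall>x\<in>S. f differentiable (at x)) \<and>
     (\<forall>v. C_k_on k S (\<lambda>x. frechet_derivative f (at x) v))"

text \<open>Only used for open \<open>S\<close>.\<close>

definition smooth_on :: "'a::euclidean_space set \<Rightarrow> ('a \<Rightarrow> 'b::real_normed_vector) \<Rightarrow> bool" where
  "smooth_on S f \<longleftrightarrow> (\<forall>k. C_k_on k S f)"

section \<open>Manifolds\<close>

text \<open>
  A chart is a domain together with a coordinate map; the values of the coordinate map outside
  the domain are irrelevant. The model space \<open>'e\<close> fixes the dimension \<open>DIM('e)\<close>.
\<close>

type_synonym ('p, 'e) chart = "'p set \<times> ('p \<Rightarrow> 'e)"

abbreviation chart_dom :: "('p, 'e) chart \<Rightarrow> 'p set" where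
  "chart_dom c \<equiv> fst c"

abbreviation chart_map :: "('p, 'e) chart \<Rightarrow> 'p \<Rightarrow> 'e" where
  "chart_map c \<equiv> snd c"

definition chart_inv :: "('p, 'e) chart \<Rightarrow> 'e \<Rightarrow> 'p" where
  "chart_inv c = inv_into (chart_dom c) (chart_map c)"

definition is_chart :: "'p topology \<Rightarrow> ('p, 'e::euclidean_space) chart \<Rightarrow> bool" where
  "is_chart X c \<longleftrightarrow>
     openin X (chart_dom c) \<and> open (chart_map c ` chart_dom c) \<and>
     homeomorphic_map (subtopology X (chart_dom c))
       (top_of_set (chart_map c ` chart_dom c)) (chart_map c)"

text \<open>
  Smooth manifolds without boundary: a space with a smooth atlas, which need not be maximal.
\<close>

definition smooth_manifold :: "'p topology \<Rightarrow> ('p, 'e::euclidean_space) chart set \<Rightarrow> bool" where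
  "smooth_manifold X A \<longleftrightarrow>
     Hausdorff_space X \<and> second_countable X \<and>
     (\<forall>c\<in>A. is_chart X c) \<and> (\<Union>c\<in>A. chart_dom c) = topspace X \<and>
     (\<forall>c\<in>A. \<forall>d\<in>A. smooth_on (chart_map c ` (chart_dom c \<inter> chart_dom d))
                              (chart_map d \<circ> chart_inv c))"

text \<open>The Jacobian at \<open>p\<close> of the map \<open>\<phi>\<close>, read in the chart \<open>c\<close> at \<open>p\<close> and \<open>d\<close> at \<open>\<phi> p\<close>.\<close>

definition jacobian ::
  "('p, 'e::euclidean_space) chart \<Rightarrow> ('q, 'd::euclidean_space) chart \<Rightarrow> ('p \<Rightarrow> 'q) \<Rightarrow> 'p \<Rightarrow> 'e \<Rightarrow> 'd"
  where
  "jacobian c d \<phi> p = frechet_derivative (chart_map d \<circ> \<phi> \<circ> chart_inv c) (at (chart_map c p))"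

text \<open>The determinant of a linear endomorphism, by the Leibniz formula in the standard basis.\<close>

definition linear_det :: "('e::euclidean_space \<Rightarrow> 'e) \<Rightarrow> real" where
  "linear_det L =
     (\<Sum>\<tau> | \<tau> permutes (Basis :: 'e set). of_int (sign \<tau>) * (\<Prod>b\<in>Basis. L b \<bullet> \<tau> b))"

definition oriented_atlas :: "('p, 'e::euclidean_space) chart set \<Rightarrow> bool" where
  "oriented_atlas A \<longleftrightarrow>
     (\<forall>c\<in>A. \<forall>d\<in>A. \<forall>p \<in> chart_dom c \<inter> chart_dom d. linear_det (jacobian c d id p) > 0)"

definition smooth_function :: "('p, 'e::euclidean_space) chart set \<Rightarrow> ('p \<Rightarrow> real) \<Rightarrow> bool" where
  "smooth_function A h \<longleftrightarrow>
     (\<forall>c\<in>A. smooth_on (chart_map c ` chart_dom c) (h \<circ> chart_inv c))"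

definition prod_atlas ::
  "('p, 'e) chart set \<Rightarrow> ('q, 'd) chart set \<Rightarrow> ('p \<times> 'q, 'e \<times> 'd) chart set" where
  "prod_atlas A A' =
     {(chart_dom c \<times> chart_dom d, map_prod (chart_map c) (chart_map d)) | c d. c \<in> A \<and> d \<in> A'}"

section \<open>Tensor fields and Riemannian metrics\<close>

text \<open>
  Tensor fields are given by their components in the charts: a tangent vector at \<open>p\<close> is
  represented in each chart \<open>c\<close> around \<open>p\<close> by an element of \<open>'e\<close>, and the representatives in
  \<open>c\<close> and \<open>d\<close> are related by \<^term>\<open>jacobian c d id p\<close>. The values at \<open>c\<close>, \<open>p\<close> matter
  only if \<open>c\<close> belongs to the atlas and \<open>p\<close> to its domain.
\<close>

type_synonym ('p, 'e) vector_field = "('p, 'e) chart \<Rightarrow> 'p \<Rightarrow> 'e"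
type_synonym ('p, 'e) one_form = "('p, 'e) chart \<Rightarrow> 'p \<Rightarrow> 'e \<Rightarrow> real"
type_synonym ('p, 'e) tensor2 = "('p, 'e) chart \<Rightarrow> 'p \<Rightarrow> 'e \<Rightarrow> 'e \<Rightarrow> real"

definition riemannian_metric ::
  "('p, 'e::euclidean_space) chart set \<Rightarrow> ('p, 'e) tensor2 \<Rightarrow> bool" where
  "riemannian_metric A g \<longleftrightarrow>
     (\<forall>c\<in>A. \<forall>p\<in>chart_dom c.
        bilinear (g c p) \<and> (\<forall>u v. g c p u v = g c p v u) \<and> (\<forall>u. u \<noteq> 0 \<longrightarrow> g c p u u > 0)) \<and>
     (\<forall>c\<in>A. \<forall>u v. smooth_on (chart_map c ` chart_dom c) (\<lambda>x. g c (chart_inv c x) u v)) \<and>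
     (\<forall>c\<in>A. \<forall>d\<in>A. \<forall>p \<in> chart_dom c \<inter> chart_dom d. \<forall>u v.
        g c p u v = g d p (jacobian c d id p u) (jacobian c d id p v))"

text \<open>
  The chart \<open>d\<close> is arbitrary: the result does not depend on it when \<open>T\<close> obeys the
  transformation law of a tensor.
\<close>

definition pullback ::
  "('q, 'd::euclidean_space) chart set \<Rightarrow> ('p \<Rightarrow> 'q) \<Rightarrow> ('q, 'd) tensor2
    \<Rightarrow> ('p, 'e::euclidean_space) tensor2" where
  "pullback A \<phi> T c p u v =
     (let d = (SOME d. d \<in> A \<and> \<phi> p \<in> chart_dom d)
      in T d (\<phi> p) (jacobian c d \<phi> p u) (jacobian c d \<phi> p v))"

definition product_metric ::
  "('p, 'e::euclidean_space) chart set \<Rightarrow> ('p, 'e) tensor2 \<Rightarrow>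
   ('q, 'd::euclidean_space) chart set \<Rightarrow> ('q, 'd) tensor2 \<Rightarrow> ('p \<times> 'q, 'e \<times> 'd) tensor2" where
  "product_metric A g A' g' c p u v = pullback A fst g c p u v + pullback A' snd g' c p u v"

section \<open>Differential operators and curvature\<close>

text \<open>Derivative of \<open>h\<close> at \<open>p\<close> in the direction with components \<open>v\<close> in the chart \<open>c\<close>.\<close>

definition chart_deriv ::
  "('p, 'e::euclidean_space) chart \<Rightarrow> ('p \<Rightarrow> 'b::real_normed_vector) \<Rightarrow> 'p \<Rightarrow> 'e \<Rightarrow> 'b" where
  "chart_deriv c h p = frechet_derivative (h \<circ> chart_inv c) (at (chart_map c p))"

definition differential :: "('p \<Rightarrow> real) \<Rightarrow> ('p, 'e::euclidean_space) one_form" where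
  "differential h c p = chart_deriv c h p"

definition dual_form ::
  "('p, 'e::euclidean_space) tensor2 \<Rightarrow> ('p, 'e) vector_field \<Rightarrow> ('p, 'e) one_form" where
  "dual_form g \<xi> c p v = g c p (\<xi> c p) v"

definition sharp ::
  "('p, 'e::euclidean_space) tensor2 \<Rightarrow> ('p, 'e) chart \<Rightarrow> 'p \<Rightarrow> ('e \<Rightarrow> real) \<Rightarrow> 'e" where
  "sharp g c p \<alpha> = (THE w. \<forall>v. g c p w v = \<alpha> v)"

definition gradient ::
  "('p, 'e::euclidean_space) tensor2 \<Rightarrow> ('p \<Rightarrow> real) \<Rightarrow> ('p, 'e) vector_field" where
  "gradient g h c p = sharp g c p (differential h c p)"

text \<open>The trace with respect to \<open>g\<close>, i.e. the trace of the endomorphism \<open>u \<mapsto> (T(u, _))\<^sup>\<sharp>\<close>.\<close>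

definition metric_trace ::
  "('p, 'e::euclidean_space) tensor2 \<Rightarrow> ('p, 'e) tensor2 \<Rightarrow> ('p, 'e) chart \<Rightarrow> 'p \<Rightarrow> real" where
  "metric_trace g T c p = (\<Sum>b\<in>Basis. sharp g c p (T c p b) \<bullet> b)"

text \<open>
  Below, vector fields on the domain of one fixed chart \<open>c\<close> are given by their components
  \<open>X :: 'p \<Rightarrow> 'e\<close> in \<open>c\<close>; constant functions are the constant combinations of the coordinate
  fields. The Christoffel symbol \<open>\<Gamma>(u, v) = \<nabla>\<^sub>u v\<close> of constant \<open>u\<close>, \<open>v\<close> is given by the Koszul
  formula, in which all brackets vanish.
\<close>

definition christoffel ::
  "('p, 'e::euclidean_space) tensor2 \<Rightarrow> ('p, 'e) chart \<Rightarrow> 'p \<Rightarrow> 'e \<Rightarrow> 'e \<Rightarrow> 'e" where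
  "christoffel g c p u v =
     sharp g c p (\<lambda>w. (chart_deriv c (\<lambda>q. g c q v w) p u + chart_deriv c (\<lambda>q. g c q u w) p v
                       - chart_deriv c (\<lambda>q. g c q u v) p w) / 2)"

definition levi_civita ::
  "('p, 'e::euclidean_space) tensor2 \<Rightarrow> ('p, 'e) chart \<Rightarrow> ('p \<Rightarrow> 'e) \<Rightarrow> ('p \<Rightarrow> 'e) \<Rightarrow> 'p \<Rightarrow> 'e" where
  "levi_civita g c X Y p = chart_deriv c Y p (X p) + christoffel g c p (X p) (Y p)"

definition lie_bracket ::
  "('p, 'e::euclidean_space) chart \<Rightarrow> ('p \<Rightarrow> 'e) \<Rightarrow> ('p \<Rightarrow> 'e) \<Rightarrow> 'p \<Rightarrow> 'e" where
  "lie_bracket c X Y p = chart_deriv c Y p (X p) - chart_deriv c X p (Y p)"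

text \<open>
  \<open>R(X, Y)Z = \<nabla>\<^sub>X \<nabla>\<^sub>Y Z - \<nabla>\<^sub>Y \<nabla>\<^sub>X Z - \<nabla>\<^bsub>[X,Y]\<^esub> Z\<close> and
  \<open>S(Y, Z) = tr(X \<mapsto> R(X, Y)Z)\<close>, so that round spheres have positive curvature.
\<close>

definition riemann ::
  "('p, 'e::euclidean_space) tensor2 \<Rightarrow> ('p, 'e) chart
    \<Rightarrow> ('p \<Rightarrow> 'e) \<Rightarrow> ('p \<Rightarrow> 'e) \<Rightarrow> ('p \<Rightarrow> 'e) \<Rightarrow> 'p \<Rightarrow> 'e" where
  "riemann g c X Y Z p =
     levi_civita g c X (levi_civita g c Y Z) p - levi_civita g c Y (levi_civita g c X Z) p
     - levi_civita g c (lie_bracket c X Y) Z p"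

definition ricci :: "('p, 'e::euclidean_space) tensor2 \<Rightarrow> ('p, 'e) tensor2" where
  "ricci g c p u v = (\<Sum>b\<in>Basis. riemann g c (\<lambda>_. b) (\<lambda>_. u) (\<lambda>_. v) p \<bullet> b)"

text \<open>The value at \<open>p\<close>, computed in the chart \<open>c\<close>.\<close>

definition scalar_curvature ::
  "('p, 'e::euclidean_space) tensor2 \<Rightarrow> ('p, 'e) chart \<Rightarrow> 'p \<Rightarrow> real" where
  "scalar_curvature g = metric_trace g (ricci g)"

definition constant_scalar_curvature ::
  "('p, 'e::euclidean_space) chart set \<Rightarrow> ('p, 'e) tensor2 \<Rightarrow> bool" where
  "constant_scalar_curvature A g \<longleftrightarrow>
     (\<exists>k. \<forall>c\<in>A. \<forall>p\<in>chart_dom c. scalar_curvature g c p = k)"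

text \<open>\<open>Hess(h)(X, Y) = X(Y h) - (\<nabla>\<^sub>X Y) h\<close>.\<close>

definition hessian ::
  "('p, 'e::euclidean_space) tensor2 \<Rightarrow> ('p \<Rightarrow> real) \<Rightarrow> ('p, 'e) tensor2" where
  "hessian g h c p u v =
     chart_deriv c (\<lambda>q. chart_deriv c h q v) p u
     - chart_deriv c h p (levi_civita g c (\<lambda>_. u) (\<lambda>_. v) p)"

text \<open>\<open>(L\<^sub>\<xi> T)(X, Y) = \<xi>(T(X, Y)) - T([\<xi>, X], Y) - T(X, [\<xi>, Y])\<close>.\<close>

definition lie_derivative ::
  "('p, 'e::euclidean_space) vector_field \<Rightarrow> ('p, 'e) tensor2 \<Rightarrow> ('p, 'e) tensor2" where
  "lie_derivative \<xi> T c p u v =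
     chart_deriv c (\<lambda>q. T c q u v) p (\<xi> c p)
     - T c p (lie_bracket c (\<xi> c) (\<lambda>_. u) p) v
     - T c p u (lie_bracket c (\<xi> c) (\<lambda>_. v) p)"

definition gradient_eta_ricci_soliton ::
  "('p, 'e::euclidean_space) chart set \<Rightarrow> ('p, 'e) tensor2 \<Rightarrow> ('p, 'e) vector_field
    \<Rightarrow> real \<Rightarrow> real \<Rightarrow> bool" where
  "gradient_eta_ricci_soliton A g \<xi> lam mu \<longleftrightarrow>
     (\<exists>h. smooth_function A h \<and> (\<forall>c\<in>A. \<forall>p\<in>chart_dom c. \<xi> c p = gradient g h c p)) \<and>
     (\<forall>c\<in>A. \<forall>p\<in>chart_dom c. \<forall>u v.
        lie_derivative \<xi> g c p u v + 2 * ricci g c p u v + 2 * lam * g c p u v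
        + 2 * mu * dual_form g \<xi> c p u * dual_form g \<xi> c p v = 0)"

end

theory Submission
  imports Defs
begin

text \<open>
  At a maximum of \<open>f\<close>, which exists by compactness, \<open>df = 0\<close> and \<open>Hess(f) \<le> 0\<close>, so tracing the
  equation for \<open>S\<^sub>B\<close> shows that the scalar curvature of \<open>B\<close> is at least \<open>- n \<lambda>\<close> there, and hence
  everywhere since it is constant. The Ricci tensor of a product metric is the sum of the Ricci
  tensors of the factors, so the scalar curvature of \<open>B \<times> F\<close> is that of \<open>B\<close> plus \<open>- m \<lambda>\<close>.
\<close>

section \<open>Inner products and orthonormal bases\<close>

text \<open>All objects are coordinate expressions in one chart, with \<open>sharp\<close> a
  definite description and \<open>chart_deriv\<close> a \<open>frechet_derivative\<close>, which is
  an arbitrary value where the function is not differentiable. The obstacle is therefore regularity: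
  curvature differentiates the Christoffel symbols, and splitting the Ricci tensor of the product
  rests on their differentiability. It comes from a Riesz-type statement for inner products
  depending on a parameter, which takes the place of the inverse matrix of the metric. The trace is
  defined over the standard basis, where the sign of the Hessian is not visible term by term;
  orthonormal expansions turn it into a sum of diagonal values. This passage requires bilinear Ricci
  tensors. Bilinearity is not derived from curvature identities but read off the equations that
  express the Ricci tensors of the two factors through tensors known to be bilinear.\<close>

locale inner_product_form =
  fixes G :: "'e::euclidean_space \<Rightarrow> 'e \<Rightarrow> real"
  assumes bilinear: "bilinear G"
    and sym: "G u v = G v u"
    and pos: "u \<noteq> 0 \<Longrightarrow> G u u > 0"
begin

lemma linear_right: "linear (G u)"
  using bilinear by (simp add: bilinear_def)

lemma linear_left: "linear (\<lambda>u. G u v)"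
  using bilinear by (simp add: bilinear_def)

lemma sum_left: "G (\<Sum>i\<in>I. c i *\<^sub>R x i) v = (\<Sum>i\<in>I. c i * G (x i) v)"
  using linear_sum[OF linear_left, of "\<lambda>i. c i *\<^sub>R x i" I] linear_scale[OF linear_left] by simp

lemma eqI:
  assumes "\<And>v. G w v = G w' v"
  shows "w = w'"
proof (rule ccontr)
  assume "w \<noteq> w'"
  then have "G (w - w') (w - w') > 0"
    using pos by simp
  then show False
    using assms by (simp add: bilinear_lsub[OF bilinear])
qed

text \<open>Gram--Schmidt, one vector of \<open>B\<close> at a time.\<close>

lemma orthonormal_expansion_finite:
  assumes "finite B"
  shows "\<exists>E. finite E \<and> (\<forall>e\<in>E. G e e = 1) \<and> (\<forall>e\<in>E. \<forall>e'\<in>E. e \<noteq> e' \<longrightarrow> G e e' = 0) \<and>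
             (\<forall>b\<in>B. b = (\<Sum>e\<in>E. G b e *\<^sub>R e))"
  using assms
proof induction
  case empty
  then show ?case by (intro exI[of _ "{}"]) simp
next
  case (insert x B)
  then obtain E where E: "finite E" "\<forall>e\<in>E. G e e = 1"
      "\<forall>e\<in>E. \<forall>e'\<in>E. e \<noteq> e' \<longrightarrow> G e e' = 0" "\<forall>b\<in>B. b = (\<Sum>e\<in>E. G b e *\<^sub>R e)"
    by blast
  define y where "y = x - (\<Sum>e\<in>E. G x e *\<^sub>R e)"
  show ?case
  proof (cases "y = 0")
    \<comment> \<open>Here \<open>x\<close> already equals its expansion over \<open>E\<close>, so
      nothing has to be added.\<close>
    case True
    then show ?thesis using E y_def by (intro exI[of _ E]) auto
  next
    case False
    have sumE: "(\<Sum>e\<in>E. c e * G e e') = c e'" if "e' \<in> E" for c :: "'e \<Rightarrow> real" and e'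
    proof -
      have "(\<Sum>e\<in>E. c e * G e e') = (\<Sum>e\<in>E. if e = e' then c e' else 0)"
        using that E(2,3) by (intro sum.cong) auto
      then show ?thesis using E(1) that by simp
    qed
    have ye: "G y e = 0" if "e \<in> E" for e
      using sumE[OF that] by (simp add: y_def bilinear_lsub[OF bilinear] sum_left)
    define r where "r = sqrt (G y y)"
    have r: "r > 0" "r * r = G y y" using pos[OF False] by (auto simp: r_def)
    define k where "k = (1 / r) *\<^sub>R y"
    have kk: "G k k = 1"
      using r pos[OF False] by (simp add: k_def bilinear_lmul[OF bilinear] bilinear_rmul[OF bilinear])
    have ke: "G k e = 0" "G e k = 0" if "e \<in> E" for e
      using ye[OF that] sym[of e k] by (simp_all add: k_def bilinear_lmul[OF bilinear])
    have kE: "k \<notin> E" using ke kk by force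
    have comb_k: "G (\<Sum>e\<in>E. c e *\<^sub>R e) k = 0" for c
      by (simp add: sum_left ke)
    have "G x k = G y k"
      using comb_k by (simp add: y_def bilinear_lsub[OF bilinear])
    also have "\<dots> = r"
      using r by (simp add: k_def bilinear_rmul[OF bilinear] field_simps)
    \<comment> \<open>The component of \<open>x\<close> along \<open>k\<close> restores exactly the
      remainder \<open>y\<close> that the expansion over \<open>E\<close> misses.\<close>
    finally have xk: "G x k *\<^sub>R k = y" using r by (simp add: k_def)
    have "b = (\<Sum>e\<in>insert k E. G b e *\<^sub>R e)" if "b \<in> insert x B" for b
    proof (cases "b = x")
      case True
      then show ?thesis using E(1) kE xk by (simp add: y_def)
    next
      case False
      then have b: "b = (\<Sum>e\<in>E. G b e *\<^sub>R e)" using that E(4) by blast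
      have "G b k = 0" using comb_k[of "\<lambda>e. G b e"] b by simp
      then show ?thesis using E(1) kE b by simp
    qed
    moreover have "\<forall>e\<in>insert k E. \<forall>e'\<in>insert k E. e \<noteq> e' \<longrightarrow> G e e' = 0"
      using E(3) ke by blast
    ultimately show ?thesis
      using E(1,2) kk by (intro exI[of _ "insert k E"]) simp
  qed
qed

text \<open>Both sides are linear in \<open>w\<close>, so agreement on \<open>Basis\<close>
  suffices. The expansion is exported without orthonormality: sharps and traces follow from this
  identity alone.\<close>

lemma orthonormal_expansion:
  obtains E where "finite E" "\<And>w. w = (\<Sum>e\<in>E. G w e *\<^sub>R e)"
proof -
  obtain E where E: "finite E" "\<forall>b\<in>Basis. b = (\<Sum>e\<in>E. G b e *\<^sub>R e)"
    using orthonormal_expansion_finite[OF finite_Basis] by blast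
  have "linear (\<lambda>w. \<Sum>e\<in>E. G w e *\<^sub>R e)"
    by (intro linearI)
      (simp_all add: bilinear_ladd[OF bilinear] bilinear_lmul[OF bilinear] scaleR_add_left
         sum.distrib scaleR_sum_right)
  then have "(\<lambda>w. w) = (\<lambda>w. \<Sum>e\<in>E. G w e *\<^sub>R e)"
    by (rule linear_eq_stdbasis[OF linear_id[unfolded id_def]]) (use E in blast)
  then show ?thesis using E(1) that by metis
qed

text \<open>Apply \<alpha> to the expansion of \<open>v\<close>. This is the existence half of Riesz
  representation: the vector with coefficients \<open>\<alpha> e\<close> represents
  \<alpha>.\<close>

lemma expansion_right:
  assumes "\<And>w. w = (\<Sum>e\<in>E. G w e *\<^sub>R e)" "linear \<alpha>"
  shows "(\<Sum>e\<in>E. \<alpha> e * G e v) = \<alpha> v"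
proof -
  have "\<alpha> v = \<alpha> (\<Sum>e\<in>E. G v e *\<^sub>R e)" using assms(1) by simp
  also have "\<dots> = (\<Sum>e\<in>E. \<alpha> e * G e v)"
    using linear_sum[OF assms(2), of "\<lambda>e. G v e *\<^sub>R e" E] linear_scale[OF assms(2)]
    by (simp add: sym mult.commute)
  finally show ?thesis ..
qed

end

section \<open>Sharps and metric traces\<close>

lemma sharp_eqI:
  assumes "inner_product_form (g c p)" "\<And>v. g c p w v = \<alpha> v"
  shows "sharp g c p \<alpha> = w"
  unfolding sharp_def
  using assms inner_product_form.eqI[OF assms(1)] by (intro the_equality) auto

lemma sharp_expansion:
  assumes "inner_product_form (g c p)" "\<And>w. w = (\<Sum>e\<in>E. g c p w e *\<^sub>R e)" "linear \<alpha>"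
  shows "sharp g c p \<alpha> = (\<Sum>e\<in>E. \<alpha> e *\<^sub>R e)"
proof -
  interpret inner_product_form "g c p" by fact
  show ?thesis
    by (rule sharp_eqI[where g=g and c=c and p=p, OF assms(1)]) (simp add: sum_left expansion_right[OF assms(2,3)])
qed

text \<open>A linear functional has a representative, given explicitly by
  \<open>sharp_expansion\<close>, so the definite description in \<open>sharp\<close> is
  met.\<close>

lemma metric_sharp:
  assumes "inner_product_form (g c p)" "linear \<alpha>"
  shows "g c p (sharp g c p \<alpha>) v = \<alpha> v"
proof -
  interpret inner_product_form "g c p" by fact
  obtain E where E: "finite E" "\<And>w. w = (\<Sum>e\<in>E. g c p w e *\<^sub>R e)"
    using orthonormal_expansion by blast
  show ?thesis
    by (simp add: sharp_expansion[where E=E] E(2)[symmetric] assms sum_left expansion_right[of E])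
qed

text \<open>Expanding the sharps over \<open>E\<close> and swapping the sums reassembles each
  \<open>e\<close> from its coordinates \<open>e \<bullet> b\<close>.\<close>

lemma metric_trace_expansion:
  assumes "inner_product_form (g c p)" "\<And>w. w = (\<Sum>e\<in>E. g c p w e *\<^sub>R e)" "bilinear (T c p)"
  shows "metric_trace g T c p = (\<Sum>e\<in>E. T c p e e)"
proof -
  have lin: "linear (T c p b)" "linear (\<lambda>u. T c p u b)" for b
    using assms(3) by (auto simp: bilinear_def)
  have "metric_trace g T c p = (\<Sum>b\<in>Basis. \<Sum>e\<in>E. T c p b e * (e \<bullet> b))"
    by (simp add: metric_trace_def sharp_expansion[where g=g and c=c and p=p and E=E, OF assms(1,2) lin(1)] inner_sum_left)
  also have "\<dots> = (\<Sum>e\<in>E. \<Sum>b\<in>Basis. (e \<bullet> b) * T c p b e)"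
    by (subst sum.swap) (simp add: mult.commute)
  also have "\<dots> = (\<Sum>e\<in>E. T c p (\<Sum>b\<in>Basis. (e \<bullet> b) *\<^sub>R b) e)"
    by (subst linear_sum[OF lin(2)]) (simp add: linear_scale[OF lin(2)])
  finally show ?thesis by (simp add: euclidean_representation)
qed

text \<open>The endomorphism whose trace is taken is \<open>k\<close> times the identity. The case
  \<open>k = 1\<close> expresses the dimension as a trace of the metric; \<open>k = - lam\<close>
  gives the scalar curvature of the Einstein factor.\<close>

lemma metric_trace_scaled_metric:
  fixes g :: "('p, 'e::euclidean_space) tensor2"
  assumes "inner_product_form (g c p)" "\<And>u v. T c p u v = k * g c p u v"
  shows "metric_trace g T c p = k * DIM('e)"
proof -
  interpret inner_product_form "g c p" by fact
  have "sharp g c p (T c p b) = k *\<^sub>R b" for b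
    by (rule sharp_eqI[where g=g and c=c and p=p, OF assms(1)]) (simp add: assms(2) bilinear_lmul[OF bilinear])
  then show ?thesis
    by (simp add: metric_trace_def mult.commute)
qed

section \<open>Differentiability of implicitly defined vectors\<close>

text \<open>A product rule in which \<open>h\<close> need only be continuous at \<open>x\<close>:
  the term with the derivative of \<open>h\<close> would carry the factor \<open>f x = 0\<close>.
  This breaks the circle in the next lemma, where \<open>h\<close> is a coordinate of the very
  vector whose differentiability is sought.\<close>

lemma vanishing_times_continuous_has_derivative:
  fixes f :: "'x::real_normed_vector \<Rightarrow> 'e::real_normed_vector" and h :: "'x \<Rightarrow> real"
  assumes f: "(f has_derivative f') (at x)" "f x = 0" and h: "(h \<longlongrightarrow> h x) (at x)"
  shows "((\<lambda>y. h y *\<^sub>R f y) has_derivative (\<lambda>v. h x *\<^sub>R f' v)) (at x)"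
proof -
  have bl: "bounded_linear f'" using f(1) by (rule has_derivative_bounded_linear)
  obtain K where K: "\<And>v. norm (f' v) \<le> norm v * K" using bounded_linear.bounded[OF bl] by blast
  have lim: "((\<lambda>y. (f y - f' (y - x)) /\<^sub>R norm (y - x)) \<longlongrightarrow> 0) (at x)"
    using f by (simp add: has_derivative_at_within)
  \<comment> \<open>The difference quotient is split into \<open>h\<close> times the remainder of
    \<open>f\<close>, and a null factor times the bounded quotient of the linear map
    \<open>f'\<close>.\<close>
  have "((\<lambda>y. h y *\<^sub>R ((f y - f' (y - x)) /\<^sub>R norm (y - x))
               + (h y - h x) *\<^sub>R (f' (y - x) /\<^sub>R norm (y - x))) \<longlongrightarrow> h x *\<^sub>R 0 + 0) (at x)"
  proof (intro tendsto_add tendsto_scaleR h lim)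
    have bnd: "norm ((h y - h x) *\<^sub>R (f' (y - x) /\<^sub>R norm (y - x))) \<le> \<bar>h y - h x\<bar> * \<bar>K\<bar>" for y
    proof -
      have "norm (f' (y - x) /\<^sub>R norm (y - x)) \<le> \<bar>K\<bar>"
      proof (cases "y = x")
        case True
        then show ?thesis using linear_0[OF bounded_linear.linear[OF bl]] by simp
      next
        case False
        have "norm (f' (y - x)) \<le> norm (y - x) * \<bar>K\<bar>"
          using K[of "y - x"] by (smt (verit) mult_left_mono norm_ge_zero)
        then show ?thesis using False by (simp add: field_simps)
      qed
      then show ?thesis unfolding norm_scaleR by (simp add: mult_left_mono)
    qed
    have "((\<lambda>y. \<bar>h y - h x\<bar> * \<bar>K\<bar>) \<longlongrightarrow> \<bar>h x - h x\<bar> * \<bar>K\<bar>) (at x)"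
      by (intro tendsto_intros h)
    then have "((\<lambda>y. \<bar>h y - h x\<bar> * \<bar>K\<bar>) \<longlongrightarrow> 0) (at x)" by simp
    then show "((\<lambda>y. (h y - h x) *\<^sub>R (f' (y - x) /\<^sub>R norm (y - x))) \<longlongrightarrow> 0) (at x)"
      by (rule Lim_null_comparison[rotated]) (use bnd in auto)
  qed
  moreover have "h y *\<^sub>R ((f y - f' (y - x)) /\<^sub>R norm (y - x))
               + (h y - h x) *\<^sub>R (f' (y - x) /\<^sub>R norm (y - x))
        = (h y *\<^sub>R f y - h x *\<^sub>R f' (y - x)) /\<^sub>R norm (y - x)" for y
    by (simp add: algebra_simps)
  ultimately show ?thesis
    using bl f(2) by (auto simp: has_derivative_at_within intro!: bounded_linear_scaleR_right bounded_linear_compose[OF bounded_linear_scaleR_right bl])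
qed

text \<open>
  If \<open>E\<close> is \<open>G x\<close>-orthonormal, then \<open>M y w = (\<Sum>e\<in>E. G y w e *\<^sub>R e)\<close> is the identity at \<open>y = x\<close>,
  and \<open>W\<close> solves the fixed point equation \<open>W y = M y (W y) - (\<Sum>b. (W y \<bullet> b) *\<^sub>R (M y b - b))\<close>
  with \<open>M y (W y)\<close> known. The equation yields first boundedness of \<open>W\<close>, then continuity at \<open>x\<close>,
  then differentiability at \<open>x\<close>.
\<close>

lemma riesz_representative_differentiable:
  fixes G :: "'x::real_normed_vector \<Rightarrow> 'e::euclidean_space \<Rightarrow> 'e \<Rightarrow> real"
  assumes "open U" "x \<in> U"
    and form: "\<And>y. y \<in> U \<Longrightarrow> inner_product_form (G y)"
    and G: "\<And>u v. (\<lambda>y. G y u v) differentiable at x"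
    and a: "\<And>v. (\<lambda>y. a y v) differentiable at x"
    and W: "\<And>y v. y \<in> U \<Longrightarrow> G y (W y) v = a y v"
  shows "W differentiable at x"
proof -
  interpret X: inner_product_form "G x" using form \<open>x \<in> U\<close> .
  obtain E where E: "finite E" "\<And>w. w = (\<Sum>e\<in>E. G x w e *\<^sub>R e)"
    using X.orthonormal_expansion by blast
  define A where "A y = (\<Sum>e\<in>E. a y e *\<^sub>R e)" for y
  define N where "N y b = (\<Sum>e\<in>E. G y b e *\<^sub>R e) - b" for y b
  have Adiff: "A differentiable at x"
    unfolding A_def using a E(1)
    by (intro differentiable_sum ballI differentiable_scaleR) auto
  have Ndiff: "(\<lambda>y. N y b) differentiable at x" for b
    unfolding N_def using G E(1)
    by (intro differentiable_diff differentiable_sum ballI differentiable_scaleR) auto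
  have Nx: "N x b = 0" for b using E(2)[of b] by (simp add: N_def)
  have fix_eq: "W y = A y - (\<Sum>b\<in>Basis. (W y \<bullet> b) *\<^sub>R N y b)" if "y \<in> U" for y
  proof -
    interpret Y: inner_product_form "G y" using form that .
    have "G y (W y) e = (\<Sum>b\<in>Basis. (W y \<bullet> b) * G y b e)" for e
      by (subst euclidean_representation[of "W y", symmetric]) (simp add: Y.sum_left)
    then have "A y = (\<Sum>e\<in>E. (\<Sum>b\<in>Basis. (W y \<bullet> b) * G y b e) *\<^sub>R e)"
      using W[OF that] by (simp add: A_def)
    also have "\<dots> = (\<Sum>b\<in>Basis. (W y \<bullet> b) *\<^sub>R (\<Sum>e\<in>E. G y b e *\<^sub>R e))"
      by (simp add: scaleR_sum_left scaleR_sum_right sum.swap[of _ E])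
    also have "\<dots> = (\<Sum>b\<in>Basis. (W y \<bullet> b) *\<^sub>R N y b) + W y"
      by (simp add: N_def scaleR_diff_right sum_subtractf euclidean_representation)
    finally show ?thesis by simp
  qed
  have evU: "\<forall>\<^sub>F y in at x. y \<in> U"
    using \<open>open U\<close> \<open>x \<in> U\<close> by (rule eventually_at_in_open')
  have Alim: "(A \<longlongrightarrow> A x) (at x)"
    using differentiable_imp_continuous_within[OF Adiff] by (simp add: continuous_within)
  have Nlim: "((\<lambda>y. N y b) \<longlongrightarrow> 0) (at x)" for b
    using differentiable_imp_continuous_within[OF Ndiff[of b]] Nx by (simp add: continuous_within)
  have sumN: "((\<lambda>y. \<Sum>b\<in>Basis. norm (N y b)) \<longlongrightarrow> 0) (at x)"
    by (rule tendsto_null_sum) (use Nlim tendsto_norm_zero in blast)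
  have bound: "norm (\<Sum>b\<in>Basis. (W y \<bullet> b) *\<^sub>R N y b) \<le> norm (W y) * (\<Sum>b\<in>Basis. norm (N y b))" for y
    unfolding sum_distrib_left
    by (rule sum_norm_le) (simp add: Basis_le_norm mult_right_mono)
  \<comment> \<open>The threshold 1/2 lets half of \<open>norm (W y)\<close> be absorbed on the left
    of the fixed point estimate; doubling what remains gives the bound
    \<open>2 * (norm (A x) + 1)\<close>.\<close>
  have "\<forall>\<^sub>F y in at x. (\<Sum>b\<in>Basis. norm (N y b)) < 1 / 2"
    using order_tendstoD(2)[OF sumN, of "1/2"] by simp
  moreover have "\<forall>\<^sub>F y in at x. norm (A y) < norm (A x) + 1"
    using order_tendstoD(2)[OF tendsto_norm[OF Alim], of "norm (A x) + 1"] by simp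
  ultimately have Wbound: "\<forall>\<^sub>F y in at x. norm (W y) \<le> 2 * (norm (A x) + 1)"
    using evU
  proof eventually_elim
    case (elim y)
    have "norm (W y) \<le> norm (A y) + norm (W y) * (\<Sum>b\<in>Basis. norm (N y b))"
      using fix_eq[OF elim(3)] bound[of y] norm_triangle_ineq4[of "A y" "\<Sum>b\<in>Basis. (W y \<bullet> b) *\<^sub>R N y b"]
      by simp
    also have "norm (W y) * (\<Sum>b\<in>Basis. norm (N y b)) \<le> norm (W y) * (1 / 2)"
      using elim(1) by (intro mult_left_mono) auto
    finally show ?case using elim(2) by simp
  qed
  have Rlim: "((\<lambda>y. \<Sum>b\<in>Basis. (W y \<bullet> b) *\<^sub>R N y b) \<longlongrightarrow> 0) (at x)"
  proof (rule Lim_null_comparison)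
    show "\<forall>\<^sub>F y in at x. norm (\<Sum>b\<in>Basis. (W y \<bullet> b) *\<^sub>R N y b)
            \<le> 2 * (norm (A x) + 1) * (\<Sum>b\<in>Basis. norm (N y b))"
      using Wbound
    proof eventually_elim
      case (elim y)
      show ?case
        by (rule order_trans[OF bound mult_right_mono[OF elim]]) (simp add: sum_nonneg)
    qed
    show "((\<lambda>y. 2 * (norm (A x) + 1) * (\<Sum>b\<in>Basis. norm (N y b))) \<longlongrightarrow> 0) (at x)"
      using tendsto_mult_right_zero[OF sumN] by blast
  qed
  have Wx: "W x = A x" using fix_eq[OF \<open>x \<in> U\<close>] by (simp add: Nx)
  have "((\<lambda>y. A y - (\<Sum>b\<in>Basis. (W y \<bullet> b) *\<^sub>R N y b)) \<longlongrightarrow> W x) (at x)"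
    using tendsto_diff[OF Alim Rlim] Wx by simp
  then have Wlim: "(W \<longlongrightarrow> W x) (at x)"
    by (rule Lim_transform_eventually) (use evU fix_eq in \<open>auto elim: eventually_mono\<close>)
  \<comment> \<open>So far \<open>W\<close> is only known to be continuous at \<open>x\<close>;
    \<open>N y b\<close> is differentiable and vanishes there, which is the situation of the product
    rule above.\<close>
  have "(\<lambda>y. (W y \<bullet> b) *\<^sub>R N y b) differentiable at x" for b
  proof -
    have "((\<lambda>y. W y \<bullet> b) \<longlongrightarrow> W x \<bullet> b) (at x)"
      by (intro tendsto_inner Wlim tendsto_const)
    then show ?thesis
      using vanishing_times_continuous_has_derivative[of "\<lambda>y. N y b" _ x "\<lambda>y. W y \<bullet> b"]
        Ndiff[of b] Nx[of b] unfolding differentiable_def by blast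
  qed
  then have "(\<lambda>y. A y - (\<Sum>b\<in>Basis. (W y \<bullet> b) *\<^sub>R N y b)) differentiable at x"
    by (intro differentiable_diff differentiable_sum ballI Adiff) auto
  then show ?thesis
    unfolding differentiable_def
    using has_derivative_transform_within_open[OF _ \<open>open U\<close> \<open>x \<in> U\<close>, of _ _ _ W] fix_eq by fastforce
qed

text \<open>Were the second derivative along \<open>v\<close> positive, the first one, which
  vanishes at \<open>x\<close>, would be positive just after \<open>x\<close> on the line in
  direction \<open>v\<close>, and \<open>h\<close> would increase there.\<close>

lemma second_derivative_nonpos_at_max:
  fixes h :: "'x::real_normed_vector \<Rightarrow> real"
  assumes "open U" "x \<in> U"
    and h: "\<And>y. y \<in> U \<Longrightarrow> h differentiable at y"
    and h2: "(\<lambda>y. frechet_derivative h (at y) v) differentiable at x"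
    and max: "\<And>y. y \<in> U \<Longrightarrow> h y \<le> h x"
  shows "frechet_derivative (\<lambda>y. frechet_derivative h (at y) v) (at x) v \<le> 0"
proof (rule ccontr)
  define D where "D y = frechet_derivative h (at y) v" for y
  assume "\<not> ?thesis"
  then have pos: "frechet_derivative D (at x) v > 0" by (simp add: D_def[abs_def])
  have dh: "(h has_derivative frechet_derivative h (at y)) (at y)" if "y \<in> U" for y
    using h[OF that] by (simp add: frechet_derivative_works)
  have dD: "(D has_derivative frechet_derivative D (at x)) (at x)"
    using h2 frechet_derivative_works unfolding D_def by blast
  have D0: "D x = 0"
    using differential_zero_maxmin[OF assms(2,1) dh[OF assms(2)]] max by (simp add: D_def)
  have line: "((\<lambda>t::real. x + t *\<^sub>R v) has_derivative (\<lambda>t. t *\<^sub>R v)) (at t)" for t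
    by (auto intro!: derivative_eq_intros)
  have along: "((\<lambda>t. k (x + t *\<^sub>R v)) has_field_derivative k' v) (at t)"
    if "(k has_derivative k') (at (x + t *\<^sub>R v))" for k :: "'x \<Rightarrow> real" and k' t
  proof -
    have "((\<lambda>t. k (x + t *\<^sub>R v)) has_derivative (\<lambda>t. k' (t *\<^sub>R v))) (at t)"
      using has_derivative_compose[OF line that] .
    moreover have "k' (s *\<^sub>R v) = k' v * s" for s
      using linear_scale[OF bounded_linear.linear[OF has_derivative_bounded_linear[OF that]]] by simp
    ultimately show ?thesis
      by (simp add: has_field_derivative_def)
  qed
  have "((\<lambda>t. D (x + t *\<^sub>R v)) has_field_derivative frechet_derivative D (at x) v) (at 0)"
    using along[of D _ 0] dD by simp
  from DERIV_pos_inc_right[OF this pos] D0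
  obtain d where d: "d > 0" "\<And>t. 0 < t \<Longrightarrow> t < d \<Longrightarrow> D (x + t *\<^sub>R v) > 0" by auto
  have "isCont (\<lambda>t::real. x + t *\<^sub>R v) 0" by (intro continuous_intros)
  then have "((\<lambda>t::real. x + t *\<^sub>R v) \<longlongrightarrow> x) (at 0)"
    by (simp add: isCont_def)
  then have "\<forall>\<^sub>F t::real in at 0. x + t *\<^sub>R v \<in> U"
    using assms(1,2) topological_tendstoD by blast
  then obtain s where s: "s > 0" "\<And>t::real. t \<noteq> 0 \<Longrightarrow> \<bar>t\<bar> < s \<Longrightarrow> x + t *\<^sub>R v \<in> U"
    by (auto simp: eventually_at dist_real_def)
  have s': "x + t *\<^sub>R v \<in> U" if "\<bar>t\<bar> < s" for t
    using s(2)[OF _ that] assms(2) by (cases "t = 0") auto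
  \<comment> \<open>Up to \<open>r\<close> the line stays in \<open>U\<close> (bound
    \<open>s\<close>) and the derivative along \<open>v\<close> is positive (bound
    \<open>d\<close>); halving makes both bounds strict.\<close>
  define r where "r = min d s / 2"
  have r: "0 < r" "r < d" "r < s" using d s by (auto simp: r_def min_def)
  have "h (x + 0 *\<^sub>R v) < h (x + r *\<^sub>R v)"
  proof (rule DERIV_pos_imp_increasing_open[OF r(1)])
    fix t :: real assume t: "0 < t" "t < r"
    then show "\<exists>y. ((\<lambda>t. h (x + t *\<^sub>R v)) has_field_derivative y) (at t) \<and> 0 < y"
      using along[OF dh[OF s'[of t]]] d(2)[of t] r by (auto simp: D_def)
  next
    show "continuous_on {0..r} (\<lambda>t. h (x + t *\<^sub>R v))"
    proof (rule continuous_at_imp_continuous_on, intro ballI)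
      fix t assume "t \<in> {0..r}"
      then have "x + t *\<^sub>R v \<in> U" using s'[of t] r by simp
      then show "isCont (\<lambda>t. h (x + t *\<^sub>R v)) t"
        using along[OF dh] DERIV_isCont by blast
    qed
  qed
  moreover have "h (x + r *\<^sub>R v) \<le> h x" using max[OF s'[of r]] r by simp
  ultimately show False by simp
qed

section \<open>Calculus in one chart\<close>

lemma smooth_on_differentiable: "smooth_on S f \<Longrightarrow> x \<in> S \<Longrightarrow> f differentiable at x"
  unfolding smooth_on_def using C_k_on.simps(2) by blast

lemma smooth_on_frechet_derivative:
  "smooth_on S f \<Longrightarrow> smooth_on S (\<lambda>x. frechet_derivative f (at x) v)"
  unfolding smooth_on_def using C_k_on.simps(2) by blast

text \<open>\<open>frechet_derivative\<close> is a choice; both functions have the same set of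
  derivatives at \<open>x\<close>, so the choices agree even where neither is
  differentiable.\<close>

lemma frechet_derivative_cong_open:
  assumes "open U" "x \<in> U" "\<And>y. y \<in> U \<Longrightarrow> f y = k y"
  shows "frechet_derivative f (at x) = frechet_derivative k (at x)"
proof -
  have "(f has_derivative D) (at x) \<longleftrightarrow> (k has_derivative D) (at x)" for D
    using has_derivative_transform_within_open[OF _ assms(1,2), of f D UNIV k]
      has_derivative_transform_within_open[OF _ assms(1,2), of k D UNIV f] assms(3) by auto
  then show ?thesis unfolding frechet_derivative_def by simp
qed

lemma differentiable_cong_open:
  assumes "open U" "x \<in> U" "\<And>y. y \<in> U \<Longrightarrow> f y = k y" "f differentiable at x"
  shows "k differentiable at x"
  using assms has_derivative_transform_within_open unfolding differentiable_def by blast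

lemma chart_deriv_const [simp]: "chart_deriv c (\<lambda>_. k) p = (\<lambda>_. 0)"
  by (simp add: chart_deriv_def comp_def)

lemma levi_civita_const: "levi_civita g c (\<lambda>_. u) (\<lambda>_. v) = (\<lambda>q. christoffel g c q u v)"
  by (simp add: levi_civita_def fun_eq_iff)

text \<open>Brackets of constant fields vanish. The last term stems from the zero bracket; for
  arbitrary \<open>g\<close> it is not known to be 0, and the product formula treats it like the
  others.\<close>

lemma riemann_const:
  "riemann g c (\<lambda>_. b) (\<lambda>_. u) (\<lambda>_. v) p =
     chart_deriv c (\<lambda>q. christoffel g c q u v) p b + christoffel g c p b (christoffel g c p u v)
     - (chart_deriv c (\<lambda>q. christoffel g c q b v) p u + christoffel g c p u (christoffel g c p b v))
     - christoffel g c p 0 v"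
  unfolding riemann_def levi_civita_const by (simp add: levi_civita_def lie_bracket_def)

locale chart_domain =
  fixes c :: "('p, 'e::euclidean_space) chart"
  assumes inj: "inj_on (chart_map c) (chart_dom c)"
    and open_image: "open (chart_map c ` chart_dom c)"
begin

lemma inv_map: "p \<in> chart_dom c \<Longrightarrow> chart_inv c (chart_map c p) = p"
  using inj by (simp add: chart_inv_def)

lemma map_inv: "x \<in> chart_map c ` chart_dom c \<Longrightarrow> chart_map c (chart_inv c x) = x"
  unfolding chart_inv_def by (rule f_inv_into_f)

lemma inv_in: "x \<in> chart_map c ` chart_dom c \<Longrightarrow> chart_inv c x \<in> chart_dom c"
  unfolding chart_inv_def by (rule inv_into_into)

abbreviation chart_differentiable :: "('p \<Rightarrow> 'r::real_normed_vector) \<Rightarrow> 'p \<Rightarrow> bool" where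
  "chart_differentiable h p \<equiv> (h \<circ> chart_inv c) differentiable at (chart_map c p)"

lemma chart_deriv_has_derivative:
  "chart_differentiable h p \<Longrightarrow>
     ((h \<circ> chart_inv c) has_derivative chart_deriv c h p) (at (chart_map c p))"
  by (simp add: chart_deriv_def frechet_derivative_works)

lemma chart_deriv_eqI:
  "((h \<circ> chart_inv c) has_derivative D) (at (chart_map c p)) \<Longrightarrow> chart_deriv c h p = D"
  unfolding chart_deriv_def by (rule frechet_derivative_at[symmetric])

lemma linear_chart_deriv: "chart_differentiable h p \<Longrightarrow> linear (chart_deriv c h p)"
  unfolding chart_deriv_def by (rule linear_frechet_derivative)

lemma chart_deriv_cong:
  assumes "p \<in> chart_dom c" "\<And>q. q \<in> chart_dom c \<Longrightarrow> h q = k q"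
  shows "chart_deriv c h p = chart_deriv c k p"
  unfolding chart_deriv_def
  by (rule frechet_derivative_cong_open[OF open_image]) (use assms inv_in in auto)

text \<open>Sums and multiples in \<open>v\<close> pass through the derivative;
  \<open>chart_deriv_cong\<close> enters because \<open>h q\<close> is linear only for
  \<open>q\<close> in the domain.\<close>

lemma linear_chart_deriv_param:
  fixes h :: "'p \<Rightarrow> 'v::real_normed_vector \<Rightarrow> 'r::real_normed_vector"
  assumes p: "p \<in> chart_dom c"
    and lin: "\<And>q. q \<in> chart_dom c \<Longrightarrow> linear (h q)"
    and diff: "\<And>v. chart_differentiable (\<lambda>q. h q v) p"
  shows "linear (\<lambda>v. chart_deriv c (\<lambda>q. h q v) p u)"
proof (rule linearI)
  fix v w
  have "chart_deriv c (\<lambda>q. h q (v + w)) p = chart_deriv c (\<lambda>q. h q v + h q w) p"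
    using lin by (intro chart_deriv_cong p linear_add)
  also have "\<dots> = (\<lambda>u. chart_deriv c (\<lambda>q. h q v) p u + chart_deriv c (\<lambda>q. h q w) p u)"
    by (rule chart_deriv_eqI)
      (use has_derivative_add[OF chart_deriv_has_derivative[OF diff[of v]]
        chart_deriv_has_derivative[OF diff[of w]]] in \<open>simp add: comp_def\<close>)
  finally show "chart_deriv c (\<lambda>q. h q (v + w)) p u
      = chart_deriv c (\<lambda>q. h q v) p u + chart_deriv c (\<lambda>q. h q w) p u" by simp
next
  fix r v
  have "chart_deriv c (\<lambda>q. h q (r *\<^sub>R v)) p = chart_deriv c (\<lambda>q. r *\<^sub>R h q v) p"
    using lin by (intro chart_deriv_cong p linear_scale)
  also have "\<dots> = (\<lambda>u. r *\<^sub>R chart_deriv c (\<lambda>q. h q v) p u)"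
    by (rule chart_deriv_eqI)
      (use has_derivative_scaleR_right[OF chart_deriv_has_derivative[OF diff[of v]]]
        in \<open>simp add: comp_def\<close>)
  finally show "chart_deriv c (\<lambda>q. h q (r *\<^sub>R v)) p u = r *\<^sub>R chart_deriv c (\<lambda>q. h q v) p u"
    by simp
qed

lemma smooth_chart_differentiable:
  assumes "smooth_on (chart_map c ` chart_dom c) (h \<circ> chart_inv c)" "p \<in> chart_dom c"
  shows "chart_differentiable h p"
  using smooth_on_differentiable[OF assms(1)] assms(2) by blast

lemma smooth_chart_deriv_differentiable:
  assumes "smooth_on (chart_map c ` chart_dom c) (h \<circ> chart_inv c)" "p \<in> chart_dom c"
  shows "chart_differentiable (\<lambda>q. chart_deriv c h q v) p"
proof (rule differentiable_cong_open[OF open_image])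
  show "(\<lambda>x. frechet_derivative (h \<circ> chart_inv c) (at x) v) differentiable at (chart_map c p)"
    using smooth_on_differentiable[OF smooth_on_frechet_derivative[OF assms(1)]] assms(2) by blast
qed (use assms(2) map_inv in \<open>auto simp: chart_deriv_def\<close>)

end

section \<open>Christoffel symbols and Hessians in one chart\<close>

locale metric_chart = chart_domain c
  for c :: "('p, 'e::euclidean_space) chart" +
  fixes g :: "('p, 'e) tensor2"
  assumes form: "p \<in> chart_dom c \<Longrightarrow> inner_product_form (g c p)"
    and smooth: "smooth_on (chart_map c ` chart_dom c) (\<lambda>x. g c (chart_inv c x) u v)"
begin

lemma g_smooth: "smooth_on (chart_map c ` chart_dom c) ((\<lambda>q. g c q u v) \<circ> chart_inv c)"
  using smooth by (simp add: comp_def)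

lemmas g_diff = smooth_chart_differentiable[OF g_smooth]
lemmas g_diff2 = smooth_chart_deriv_differentiable[OF g_smooth]

text \<open>The Christoffel symbol with its index lowered: \<open>christoffel g c p u v\<close> is
  the sharp of this covector in \<open>w\<close>. Identities between Christoffel symbols are tested
  on it.\<close>

definition koszul :: "'p \<Rightarrow> 'e \<Rightarrow> 'e \<Rightarrow> 'e \<Rightarrow> real" where
  "koszul p u v w = (chart_deriv c (\<lambda>q. g c q v w) p u + chart_deriv c (\<lambda>q. g c q u w) p v
                     - chart_deriv c (\<lambda>q. g c q u v) p w) / 2"

lemma linear_g_deriv:
  assumes "p \<in> chart_dom c"
  shows "linear (\<lambda>v. chart_deriv c (\<lambda>q. g c q u v) p w)"
    and "linear (\<lambda>u. chart_deriv c (\<lambda>q. g c q u v) p w)"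
    and "linear (\<lambda>w. chart_deriv c (\<lambda>q. g c q u v) p w)"
  using assms form
  by (auto intro!: linear_chart_deriv_param g_diff linear_chart_deriv
      intro: inner_product_form.linear_left inner_product_form.linear_right)

lemma linear_koszul:
  assumes "p \<in> chart_dom c"
  shows "linear (\<lambda>w. koszul p u v w)" "linear (\<lambda>v. koszul p u v w)" "linear (\<lambda>u. koszul p u v w)"
  unfolding koszul_def
  by (auto intro!: linearI simp: linear_add[OF linear_g_deriv(1)[OF assms]]
      linear_add[OF linear_g_deriv(2)[OF assms]] linear_add[OF linear_g_deriv(3)[OF assms]]
      linear_scale[OF linear_g_deriv(1)[OF assms]]
      linear_scale[OF linear_g_deriv(2)[OF assms]] linear_scale[OF linear_g_deriv(3)[OF assms]]
      field_simps)

lemma metric_christoffel: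
  "p \<in> chart_dom c \<Longrightarrow> g c p (christoffel g c p u v) w = koszul p u v w"
  using metric_sharp[where g=g and c=c and p=p, OF form linear_koszul(1)]
  by (simp add: christoffel_def koszul_def)

lemma christoffel_eqI:
  assumes "p \<in> chart_dom c" "\<And>w. g c p x w = koszul p u v w"
  shows "christoffel g c p u v = x"
  using inner_product_form.eqI[OF form] metric_christoffel assms by metis

text \<open>Positive definiteness lets a vector be tested by pairing, so linearity of
  \<open>koszul\<close> in \<open>u\<close> and \<open>v\<close> carries over.\<close>

lemma bilinear_christoffel:
  assumes "p \<in> chart_dom c"
  shows "bilinear (christoffel g c p)"
proof -
  interpret inner_product_form "g c p" using form assms .
  note ext = christoffel_eqI[OF assms] metric_christoffel[OF assms]
  show ?thesis
    unfolding bilinear_def using assms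
    by (auto intro!: linearI ext(1) simp: bilinear_ladd[OF bilinear] bilinear_lmul[OF bilinear] ext(2)
        linear_add[OF linear_koszul(2)] linear_add[OF linear_koszul(3)]
        linear_scale[OF linear_koszul(2)] linear_scale[OF linear_koszul(3)])
qed

text \<open>The symbol represents the functional \<open>koszul\<close> with respect to the metric,
  and both vary differentiably with the point: \<open>koszul\<close> involves first derivatives of
  the metric, which are differentiable again by smoothness. This gives meaning to the derivatives
  inside \<open>riemann\<close>.\<close>

lemma christoffel_differentiable:
  assumes p: "p \<in> chart_dom c"
  shows "chart_differentiable (\<lambda>q. christoffel g c q u v) p"
proof (rule riesz_representative_differentiable[OF open_image,
      where G="\<lambda>x. g c (chart_inv c x)" and a="\<lambda>x. koszul (chart_inv c x) u v"])
  show "chart_map c p \<in> chart_map c ` chart_dom c" using p by blast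
  show "(\<lambda>x. g c (chart_inv c x) u v) differentiable at (chart_map c p)" for u v
    using g_diff[OF p] by (simp add: comp_def)
  show "(\<lambda>x. koszul (chart_inv c x) u v w) differentiable at (chart_map c p)" for w
    unfolding koszul_def using g_diff2[OF p]
    by (intro differentiable_divide differentiable_add differentiable_diff) (auto simp: comp_def)
qed (use form inv_in metric_christoffel in auto)

lemma bilinear_hessian:
  assumes f: "smooth_on (chart_map c ` chart_dom c) (f \<circ> chart_inv c)" and p: "p \<in> chart_dom c"
  shows "bilinear (hessian g f c p)"
proof -
  have l1: "linear (\<lambda>v. chart_deriv c (\<lambda>q. chart_deriv c f q v) p u)" for u
    by (intro linear_chart_deriv_param p smooth_chart_deriv_differentiable f
        linear_chart_deriv smooth_chart_differentiable)
  have l2: "linear (\<lambda>u. chart_deriv c (\<lambda>q. chart_deriv c f q v) p u)" for v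
    by (intro linear_chart_deriv p smooth_chart_deriv_differentiable f)
  have l3: "linear (chart_deriv c f p)"
    by (intro linear_chart_deriv p smooth_chart_differentiable f)
  note b = bilinear_christoffel[OF p]
  show ?thesis
    unfolding bilinear_def hessian_def levi_civita_const
    by (auto intro!: linearI simp: linear_add[OF l1] linear_add[OF l2] linear_add[OF l3]
        linear_scale[OF l1] linear_scale[OF l2] linear_scale[OF l3] right_diff_distrib
        bilinear_ladd[OF b] bilinear_radd[OF b] bilinear_lmul[OF b] bilinear_rmul[OF b])
qed

text \<open>The differential vanishes at a maximum over the open chart image, which kills the
  connection term of the Hessian; what remains is an ordinary second derivative in
  coordinates.\<close>

lemma differential_zero_and_hessian_nonpos_at_max:
  assumes f: "smooth_on (chart_map c ` chart_dom c) (f \<circ> chart_inv c)" and p: "p \<in> chart_dom c"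
    and max: "\<And>q. q \<in> chart_dom c \<Longrightarrow> f q \<le> f p"
  shows "differential f c p v = 0" "hessian g f c p v v \<le> 0"
proof -
  let ?h = "f \<circ> chart_inv c" and ?U = "chart_map c ` chart_dom c"
  have m: "\<forall>y\<in>?U. ?h y \<le> ?h (chart_map c p)" using max p inv_in inv_map by auto
  have d0: "chart_deriv c f p = (\<lambda>v. 0)"
    using differential_zero_maxmin[OF _ open_image chart_deriv_has_derivative] 
      smooth_chart_differentiable[OF f p] m p by blast
  then show "differential f c p v = 0" by (simp add: differential_def)
  \<comment> \<open>The two inner derivatives agree only where \<open>chart_map c\<close> inverts
    \<open>chart_inv c\<close>, that is on the open chart image, which is enough for the outer
    one.\<close>
  have "chart_deriv c (\<lambda>q. chart_deriv c f q v) p v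
      = frechet_derivative (\<lambda>y. frechet_derivative ?h (at y) v) (at (chart_map c p)) v"
    unfolding chart_deriv_def
    by (rule fun_cong[OF frechet_derivative_cong_open[OF open_image]]) (use p map_inv in auto)
  also have "\<dots> \<le> 0"
    using p m smooth_on_differentiable[OF smooth_on_frechet_derivative[OF f]]
    by (intro second_derivative_nonpos_at_max[OF open_image] smooth_on_differentiable[OF f]) auto
  finally show "hessian g f c p v v \<le> 0" by (simp add: hessian_def d0)
qed

end

section \<open>Product charts\<close>

lemma sum_Basis_prod:
  fixes h :: "'a::euclidean_space \<times> 'b::euclidean_space \<Rightarrow> 'r::comm_monoid_add"
  shows "sum h Basis = (\<Sum>i\<in>Basis. h (i, 0)) + (\<Sum>j\<in>Basis. h (0, j))"
proof -
  have "inj_on (\<lambda>u. (u::'a, 0::'b)) Basis" "inj_on (\<lambda>u. (0::'a, u::'b)) Basis"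
    by (auto intro!: inj_onI)
  then show ?thesis
    unfolding Basis_prod_def
    by (subst sum.union_disjoint) (auto simp: Basis_prod_def sum.reindex)
qed

text \<open>\<open>inv_into\<close> is determined only on the image, where injectivity of the
  product map leaves a single preimage.\<close>

lemma chart_inv_pair:
  assumes "chart_domain c1" "chart_domain c2"
    and c: "c = (chart_dom c1 \<times> chart_dom c2, map_prod (chart_map c1) (chart_map c2))"
    and xy: "x \<in> chart_map c1 ` chart_dom c1" "y \<in> chart_map c2 ` chart_dom c2"
  shows "chart_inv c (x, y) = (chart_inv c1 x, chart_inv c2 y)"
proof -
  interpret B: chart_domain c1 by fact
  interpret F: chart_domain c2 by fact
  have "inj_on (map_prod (chart_map c1) (chart_map c2)) (chart_dom c1 \<times> chart_dom c2)"
    by (rule map_prod_inj_on[OF B.inj F.inj])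
  from inv_into_f_f[OF this, of "(chart_inv c1 x, chart_inv c2 y)"] show ?thesis
    unfolding chart_inv_def[of c]
    using xy by (simp add: c B.inv_in F.inv_in B.map_inv F.map_inv)
qed

text \<open>The metric enters through its block form over the chart domain, which keeps this
  calculus apart from \<open>pullback\<close>; that the product metric has this form is a matter of
  coordinate changes.\<close>

locale product_chart = B: metric_chart c1 g1 + F: metric_chart c2 g2
  for c1 :: "('p, 'b::euclidean_space) chart" and g1 :: "('p, 'b) tensor2"
    and c2 :: "('q, 'c::euclidean_space) chart" and g2 :: "('q, 'c) tensor2" +
  fixes c :: "('p \<times> 'q, 'b \<times> 'c) chart" and g :: "('p \<times> 'q, 'b \<times> 'c) tensor2"
  assumes c: "c = (chart_dom c1 \<times> chart_dom c2, map_prod (chart_map c1) (chart_map c2))"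
    and g: "p \<in> chart_dom c1 \<Longrightarrow> q \<in> chart_dom c2 \<Longrightarrow>
              g c (p, q) u v = g1 c1 p (fst u) (fst v) + g2 c2 q (snd u) (snd v)"
begin

text \<open>The description of \<open>h\<close> by \<open>k\<close> holds only over the chart
  domain; its image is an open product, so the derivative may be computed from \<open>k\<close> and
  the inverse charts of the factors.\<close>

lemma has_derivative_transfer:
  assumes p: "p \<in> chart_dom c1" and q: "q \<in> chart_dom c2"
    and h: "\<And>a b. a \<in> chart_dom c1 \<Longrightarrow> b \<in> chart_dom c2 \<Longrightarrow> h (a, b) = k a b"
    and D: "((\<lambda>z. k (chart_inv c1 (fst z)) (chart_inv c2 (snd z))) has_derivative D)
              (at (chart_map c1 p, chart_map c2 q))"
  shows "chart_deriv c h (p, q) = D"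
proof -
  have "open (chart_map c1 ` chart_dom c1 \<times> chart_map c2 ` chart_dom c2)"
    by (intro open_Times B.open_image F.open_image)
  then have "((h \<circ> chart_inv c) has_derivative D) (at (chart_map c1 p, chart_map c2 q))"
    by (rule has_derivative_transform_within_open[OF D])
      (use p q in \<open>auto simp: chart_inv_pair[OF B.chart_domain_axioms F.chart_domain_axioms c] h B.inv_map F.inv_map\<close>)
  moreover have "chart_map c (p, q) = (chart_map c1 p, chart_map c2 q)" by (simp add: c)
  ultimately show ?thesis
    unfolding chart_deriv_def by (metis frechet_derivative_at)
qed

lemma has_derivative_fst_snd:
  assumes "B.chart_differentiable k p" "F.chart_differentiable l q"
  shows "((\<lambda>z. k (chart_inv c1 (fst z))) has_derivative (\<lambda>u. chart_deriv c1 k p (fst u)))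
           (at (chart_map c1 p, chart_map c2 q))"
    and "((\<lambda>z. l (chart_inv c2 (snd z))) has_derivative (\<lambda>u. chart_deriv c2 l q (snd u)))
           (at (chart_map c1 p, chart_map c2 q))"
proof -
  show "((\<lambda>z. k (chart_inv c1 (fst z))) has_derivative (\<lambda>u. chart_deriv c1 k p (fst u)))
           (at (chart_map c1 p, chart_map c2 q))"
    using has_derivative_compose[OF has_derivative_fst[OF has_derivative_ident],
        where g="k \<circ> chart_inv c1"] B.chart_deriv_has_derivative[OF assms(1)]
    by fastforce
  show "((\<lambda>z. l (chart_inv c2 (snd z))) has_derivative (\<lambda>u. chart_deriv c2 l q (snd u)))
           (at (chart_map c1 p, chart_map c2 q))"
    using has_derivative_compose[OF has_derivative_snd[OF has_derivative_ident],
        where g="l \<circ> chart_inv c2"] F.chart_deriv_has_derivative[OF assms(2)]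
    by fastforce
qed

lemma chart_deriv_add:
  assumes "p \<in> chart_dom c1" "q \<in> chart_dom c2"
    and "B.chart_differentiable k p" "F.chart_differentiable l q"
    and "\<And>a b. a \<in> chart_dom c1 \<Longrightarrow> b \<in> chart_dom c2 \<Longrightarrow> h (a, b) = k a + l b"
  shows "chart_deriv c h (p, q) = (\<lambda>u. chart_deriv c1 k p (fst u) + chart_deriv c2 l q (snd u))"
  by (rule has_derivative_transfer[where k="\<lambda>a b. k a + l b", OF assms(1,2,5)])
    (auto intro!: has_derivative_add has_derivative_fst_snd assms(3,4))

lemma chart_deriv_Pair:
  assumes "p \<in> chart_dom c1" "q \<in> chart_dom c2"
    and "B.chart_differentiable k p" "F.chart_differentiable l q"
    and "\<And>a b. a \<in> chart_dom c1 \<Longrightarrow> b \<in> chart_dom c2 \<Longrightarrow> h (a, b) = (k a, l b)"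
  shows "chart_deriv c h (p, q) = (\<lambda>u. (chart_deriv c1 k p (fst u), chart_deriv c2 l q (snd u)))"
  by (rule has_derivative_transfer[where k="\<lambda>a b. (k a, l b)", OF assms(1,2,5)])
    (auto intro!: has_derivative_Pair has_derivative_fst_snd assms(3,4))

lemma product_form:
  assumes p: "p \<in> chart_dom c1" and q: "q \<in> chart_dom c2"
  shows "inner_product_form (g c (p, q))"
proof -
  interpret b: inner_product_form "g1 c1 p" using B.form p .
  interpret f: inner_product_form "g2 c2 q" using F.form q .
  note bl = b.bilinear f.bilinear
  show ?thesis
  proof
    show "bilinear (g c (p, q))"
      unfolding bilinear_def
      by (intro conjI allI linearI)
        (simp_all add: g[OF p q] bl[THEN bilinear_ladd] bl[THEN bilinear_radd]
          bl[THEN bilinear_lmul] bl[THEN bilinear_rmul] distrib_left)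
    show "g c (p, q) u v = g c (p, q) v u" for u v
      by (simp add: g[OF p q] b.sym[of "fst u"] f.sym[of "snd u"])
    show "g c (p, q) u u > 0" if "u \<noteq> 0" for u
    proof -
      have "g1 c1 p x x \<ge> 0" for x
        using b.pos[of x] bilinear_lzero[OF bl(1)] by (cases "x = 0") auto
      moreover have "g2 c2 q x x \<ge> 0" for x
        using f.pos[of x] bilinear_lzero[OF bl(2)] by (cases "x = 0") auto
      moreover have "g1 c1 p (fst u) (fst u) > 0 \<or> g2 c2 q (snd u) (snd u) > 0"
        using that b.pos[of "fst u"] f.pos[of "snd u"] by (auto simp: prod_eq_iff)
      ultimately show ?thesis
        unfolding g[OF p q] by (metis add_pos_nonneg add_nonneg_pos)
    qed
  qed
qed

text \<open>Derivatives of the block metric split, hence so does the Koszul expression; the pair of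
  factor symbols represents it, and representatives are unique.\<close>

lemma christoffel_product:
  assumes p: "p \<in> chart_dom c1" and q: "q \<in> chart_dom c2"
  shows "christoffel g c (p, q) u v
           = (christoffel g1 c1 p (fst u) (fst v), christoffel g2 c2 q (snd u) (snd v))"
proof -
  have "chart_deriv c (\<lambda>z. g c z u v) (p, q) w
      = chart_deriv c1 (\<lambda>a. g1 c1 a (fst u) (fst v)) p (fst w)
        + chart_deriv c2 (\<lambda>b. g2 c2 b (snd u) (snd v)) q (snd w)" for u v w
    by (subst chart_deriv_add[OF p q, where k="\<lambda>a. g1 c1 a (fst u) (fst v)"
            and l="\<lambda>b. g2 c2 b (snd u) (snd v)"])
      (simp_all only: B.g_diff[OF p] F.g_diff[OF q] g)
  then show ?thesis
    unfolding christoffel_def[of g]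
    by (intro sharp_eqI[where g=g and c=c and p="(p, q)", OF product_form[OF p q]])
      (simp add: g[OF p q] B.metric_christoffel[OF p] F.metric_christoffel[OF q]
        B.koszul_def F.koszul_def field_simps)
qed

text \<open>The derivative of a pair of Christoffel symbols may be taken componentwise because both
  components are differentiable; here \<open>christoffel_differentiable\<close> enters.\<close>

lemma riemann_product:
  assumes p: "p \<in> chart_dom c1" and q: "q \<in> chart_dom c2"
  shows "riemann g c (\<lambda>_. w) (\<lambda>_. u) (\<lambda>_. v) (p, q)
           = (riemann g1 c1 (\<lambda>_. fst w) (\<lambda>_. fst u) (\<lambda>_. fst v) p,
              riemann g2 c2 (\<lambda>_. snd w) (\<lambda>_. snd u) (\<lambda>_. snd v) q)"
proof -
  have "chart_deriv c (\<lambda>z. christoffel g c z u v) (p, q) w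
      = (chart_deriv c1 (\<lambda>a. christoffel g1 c1 a (fst u) (fst v)) p (fst w),
         chart_deriv c2 (\<lambda>b. christoffel g2 c2 b (snd u) (snd v)) q (snd w))" for u v w
    by (subst chart_deriv_Pair[OF p q, where k="\<lambda>a. christoffel g1 c1 a (fst u) (fst v)"
            and l="\<lambda>b. christoffel g2 c2 b (snd u) (snd v)"])
      (simp_all only: B.christoffel_differentiable[OF p] F.christoffel_differentiable[OF q]
        christoffel_product)
  then show ?thesis
    by (simp add: riemann_const christoffel_product[OF p q])
qed

text \<open>The defining trace runs over the vectors \<open>(i, 0)\<close> and
  \<open>(0, j)\<close>, and each of them sees only the curvature component of its own
  factor.\<close>

lemma ricci_product:
  assumes p: "p \<in> chart_dom c1" and q: "q \<in> chart_dom c2"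
  shows "ricci g c (p, q) u v = ricci g1 c1 p (fst u) (fst v) + ricci g2 c2 q (snd u) (snd v)"
  by (simp add: ricci_def riemann_product[OF p q] sum_Basis_prod)

text \<open>The sharp of a functional split over the factors is the pair of sharps; bilinearity of
  \<open>T1\<close> and \<open>T2\<close> ensures that these exist.\<close>

lemma metric_trace_product:
  assumes p: "p \<in> chart_dom c1" and q: "q \<in> chart_dom c2"
    and T: "\<And>u v. T c (p, q) u v = T1 c1 p (fst u) (fst v) + T2 c2 q (snd u) (snd v)"
    and T1: "bilinear (T1 c1 p)" and T2: "bilinear (T2 c2 q)"
  shows "metric_trace g T c (p, q) = metric_trace g1 T1 c1 p + metric_trace g2 T2 c2 q"
proof -
  have "sharp g c (p, q) (T c (p, q) u)
      = (sharp g1 c1 p (T1 c1 p (fst u)), sharp g2 c2 q (T2 c2 q (snd u)))" for u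
  proof -
    have "linear (T1 c1 p (fst u))" "linear (T2 c2 q (snd u))"
      using T1 T2 by (simp_all add: bilinear_def)
    note sharps = metric_sharp[where g=g1 and c=c1 and p=p, OF B.form[OF p] this(1)]
      metric_sharp[where g=g2 and c=c2 and p=q, OF F.form[OF q] this(2)]
    show ?thesis
      by (rule sharp_eqI[where g=g and c=c and p="(p, q)", OF product_form[OF p q]])
        (simp only: g[OF p q] T fst_conv snd_conv sharps)
  qed
  then show ?thesis
    by (simp add: metric_trace_def sum_Basis_prod)
qed

lemma scalar_curvature_product:
  assumes "p \<in> chart_dom c1" "q \<in> chart_dom c2"
    and "bilinear (ricci g1 c1 p)" "bilinear (ricci g2 c2 q)"
  shows "scalar_curvature g c (p, q) = scalar_curvature g1 c1 p + scalar_curvature g2 c2 q"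
  unfolding scalar_curvature_def
  by (rule metric_trace_product[where T="ricci g" and ?T1.0="ricci g1" and ?T2.0="ricci g2",
        OF assms(1,2) ricci_product[OF assms(1,2)] assms(3,4)])

end

section \<open>Riemannian manifolds\<close>

lemma smooth_manifold_chart:
  assumes "smooth_manifold X A" "c \<in> A"
  shows "chart_domain c" "openin X (chart_dom c)"
    "homeomorphic_map (subtopology X (chart_dom c)) (top_of_set (chart_map c ` chart_dom c)) (chart_map c)"
proof -
  have ch: "is_chart X c" using assms by (simp add: smooth_manifold_def)
  then show "openin X (chart_dom c)"
    and hm: "homeomorphic_map (subtopology X (chart_dom c)) (top_of_set (chart_map c ` chart_dom c)) (chart_map c)"
    by (auto simp: is_chart_def)
  then have "topspace (subtopology X (chart_dom c)) = chart_dom c"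
    by (auto dest: openin_subset)
  then show "chart_domain c"
    using homeomorphic_imp_injective_map[OF hm] ch by (simp add: chart_domain_def is_chart_def)
qed

lemma smooth_manifold_cover: "smooth_manifold X A \<Longrightarrow> (\<Union>c\<in>A. chart_dom c) = topspace X"
  unfolding smooth_manifold_def by (elim conjE)

lemma riemannian_metric_chart:
  assumes "smooth_manifold X A" "riemannian_metric A g" "c \<in> A"
  shows "metric_chart c g"
proof (intro metric_chart.intro metric_chart_axioms.intro smooth_manifold_chart(1)[OF assms(1,3)])
  show "inner_product_form (g c p)" if "p \<in> chart_dom c" for p
    using assms(2,3) that unfolding riemannian_metric_def by (intro inner_product_form.intro) blast+
  show "smooth_on (chart_map c ` chart_dom c) (\<lambda>x. g c (chart_inv c x) u v)" for u v
    using assms(2,3) unfolding riemannian_metric_def by blast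
qed

lemma transition_has_derivative:
  assumes M: "smooth_manifold X A" "c \<in> A" "d \<in> A" and p: "p \<in> chart_dom c \<inter> chart_dom d"
  shows "open (chart_map c ` (chart_dom c \<inter> chart_dom d))"
    and "((chart_map d \<circ> chart_inv c) has_derivative jacobian c d id p) (at (chart_map c p))"
proof -
  interpret chart_domain c by (rule smooth_manifold_chart(1)[OF M(1,2)])
  have "openin (subtopology X (chart_dom c)) (chart_dom c \<inter> chart_dom d)"
    using smooth_manifold_chart(2)[OF M(1,3)] by (auto intro: openin_subtopology_Int2)
  then have "openin (top_of_set (chart_map c ` chart_dom c)) (chart_map c ` (chart_dom c \<inter> chart_dom d))"
    using homeomorphic_map_openness_eq[OF smooth_manifold_chart(3)[OF M(1,2)]] by blast
  then show "open (chart_map c ` (chart_dom c \<inter> chart_dom d))"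
    using open_image openin_open_trans by blast
  have "smooth_on (chart_map c ` (chart_dom c \<inter> chart_dom d)) (chart_map d \<circ> chart_inv c)"
    using M by (simp add: smooth_manifold_def)
  then have "(chart_map d \<circ> chart_inv c) differentiable at (chart_map c p)"
    using smooth_on_differentiable p by blast
  then show "((chart_map d \<circ> chart_inv c) has_derivative jacobian c d id p) (at (chart_map c p))"
    by (simp add: jacobian_def frechet_derivative_works)
qed

text \<open>In coordinates, a projection read in a factor chart is a transition map of that factor
  after \<open>fst\<close> or \<open>snd\<close>. The target charts are arbitrary because
  \<open>pullback\<close> selects one by choice.\<close>

lemma jacobian_fst_snd:
  assumes M1: "smooth_manifold X1 A1" "c1 \<in> A1" "d1 \<in> A1" and p: "p \<in> chart_dom c1 \<inter> chart_dom d1"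
    and M2: "smooth_manifold X2 A2" "c2 \<in> A2" "d2 \<in> A2" and q: "q \<in> chart_dom c2 \<inter> chart_dom d2"
    and c: "c = (chart_dom c1 \<times> chart_dom c2, map_prod (chart_map c1) (chart_map c2))"
  shows "jacobian c d1 fst (p, q) u = jacobian c1 d1 id p (fst u)"
    and "jacobian c d2 snd (p, q) u = jacobian c2 d2 id q (snd u)"
proof -
  let ?V = "chart_map c1 ` (chart_dom c1 \<inter> chart_dom d1) \<times> chart_map c2 ` (chart_dom c2 \<inter> chart_dom d2)"
  note T1 = transition_has_derivative[OF M1 p] and T2 = transition_has_derivative[OF M2 q]
  have V: "open ?V" "(chart_map c1 p, chart_map c2 q) \<in> ?V"
    using T1(1) T2(1) p q by (auto intro: open_Times)
  have inv: "chart_inv c z = (chart_inv c1 (fst z), chart_inv c2 (snd z))" if "z \<in> ?V" for z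
    using chart_inv_pair[OF smooth_manifold_chart(1)[OF M1(1,2)] smooth_manifold_chart(1)[OF M2(1,2)] c,
        of "fst z" "snd z"] that by auto
  have cm: "chart_map c (p, q) = (chart_map c1 p, chart_map c2 q)" by (simp add: c)
  have "((\<lambda>z. (chart_map d1 \<circ> chart_inv c1) (fst z)) has_derivative (\<lambda>u. jacobian c1 d1 id p (fst u)))
      (at (chart_map c1 p, chart_map c2 q))"
    by (rule has_derivative_compose[OF has_derivative_fst[OF has_derivative_ident]])
      (use T1(2) in \<open>simp only: fst_conv\<close>)
  then have "((chart_map d1 \<circ> fst \<circ> chart_inv c) has_derivative (\<lambda>u. jacobian c1 d1 id p (fst u)))
      (at (chart_map c1 p, chart_map c2 q))"
    by (rule has_derivative_transform_within_open[OF _ V]) (simp add: inv)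
  then show "jacobian c d1 fst (p, q) u = jacobian c1 d1 id p (fst u)"
    unfolding jacobian_def[of c] cm by (metis frechet_derivative_at)
  have "((\<lambda>z. (chart_map d2 \<circ> chart_inv c2) (snd z)) has_derivative (\<lambda>u. jacobian c2 d2 id q (snd u)))
      (at (chart_map c1 p, chart_map c2 q))"
    by (rule has_derivative_compose[OF has_derivative_snd[OF has_derivative_ident]])
      (use T2(2) in \<open>simp only: snd_conv\<close>)
  then have "((chart_map d2 \<circ> snd \<circ> chart_inv c) has_derivative (\<lambda>u. jacobian c2 d2 id q (snd u)))
      (at (chart_map c1 p, chart_map c2 q))"
    by (rule has_derivative_transform_within_open[OF _ V]) (simp add: inv)
  then show "jacobian c d2 snd (p, q) u = jacobian c2 d2 id q (snd u)"
    unfolding jacobian_def[of c] cm by (metis frechet_derivative_at)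
qed

text \<open>On each chart domain \<open>f\<close> is \<open>f \<circ> chart_inv c\<close> after the
  homeomorphism \<open>chart_map c\<close>; these continuous pieces are pasted. Compactness can then
  provide the maximum of \<open>f\<close>.\<close>

lemma continuous_map_smooth_function:
  assumes "smooth_manifold X A" "smooth_function A f"
  shows "continuous_map X euclideanreal f"
proof (rule pasting_lemma[where I=A and T=chart_dom and f="\<lambda>_. f"])
  fix c assume c: "c \<in> A"
  interpret chart_domain c by (rule smooth_manifold_chart(1)[OF assms(1) c])
  have sm: "smooth_on (chart_map c ` chart_dom c) (f \<circ> chart_inv c)"
    using assms(2) c by (simp add: smooth_function_def)
  then have cont: "continuous_on (chart_map c ` chart_dom c) (f \<circ> chart_inv c)"
    unfolding smooth_on_def using C_k_on.simps(1) by blast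
  have "continuous_map (subtopology X (chart_dom c)) euclideanreal ((f \<circ> chart_inv c) \<circ> chart_map c)"
    by (rule continuous_map_compose[OF homeomorphic_imp_continuous_map[OF smooth_manifold_chart(3)[OF assms(1) c]]])
      (simp only: continuous_map_iff_continuous cont)
  then show "continuous_map (subtopology X (chart_dom c)) euclideanreal f"
    by (rule continuous_map_eq) (simp add: inv_map)
next
  show "\<exists>c. c \<in> A \<and> x \<in> chart_dom c \<and> f x = f x" if "x \<in> topspace X" for x
    using that smooth_manifold_cover[OF assms(1)] by blast
next
  show "openin X (chart_dom c)" if "c \<in> A" for c
    using smooth_manifold_chart(2)[OF assms(1) that] .
qed (rule refl)

lemma product_metric_chart:
  assumes M1: "smooth_manifold X1 A1" "riemannian_metric A1 g1" "c1 \<in> A1"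
    and M2: "smooth_manifold X2 A2" "riemannian_metric A2 g2" "c2 \<in> A2"
    and c: "c = (chart_dom c1 \<times> chart_dom c2, map_prod (chart_map c1) (chart_map c2))"
  shows "product_chart c1 g1 c2 g2 c (product_metric A1 g1 A2 g2)"
proof (intro product_chart.intro product_chart_axioms.intro riemannian_metric_chart[OF M1]
    riemannian_metric_chart[OF M2] c)
  fix p q u v
  assume p: "p \<in> chart_dom c1" and q: "q \<in> chart_dom c2"
  \<comment> \<open>These are the charts that \<open>pullback\<close> selects. They may differ from
    \<open>c1\<close> and \<open>c2\<close>; the transformation law of the metrics, in
    \<open>e1\<close> and \<open>e2\<close>, brings the values back.\<close>
  define d1 where "d1 = (SOME d. d \<in> A1 \<and> p \<in> chart_dom d)"
  define d2 where "d2 = (SOME d. d \<in> A2 \<and> q \<in> chart_dom d)"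
  have d1: "d1 \<in> A1 \<and> p \<in> chart_dom d1"
    unfolding d1_def by (rule someI[of _ c1]) (simp add: p M1(3))
  have d2: "d2 \<in> A2 \<and> q \<in> chart_dom d2"
    unfolding d2_def by (rule someI[of _ c2]) (simp add: q M2(3))
  have e1: "g1 d1 p (jacobian c1 d1 id p u) (jacobian c1 d1 id p v) = g1 c1 p u v" for u v
    using M1(2,3) d1 p unfolding riemannian_metric_def by (metis IntI)
  have e2: "g2 d2 q (jacobian c2 d2 id q u) (jacobian c2 d2 id q v) = g2 c2 q u v" for u v
    using M2(2,3) d2 q unfolding riemannian_metric_def by (metis IntI)
  have pd: "p \<in> chart_dom c1 \<inter> chart_dom d1" "q \<in> chart_dom c2 \<inter> chart_dom d2"
    using d1 d2 p q by auto
  note J = jacobian_fst_snd[OF M1(1,3) conjunct1[OF d1] pd(1) M2(1,3) conjunct1[OF d2] pd(2) c]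
  show "product_metric A1 g1 A2 g2 c (p, q) u v = g1 c1 p (fst u) (fst v) + g2 c2 q (snd u) (snd v)"
    by (simp only: product_metric_def pullback_def Let_def fst_conv snd_conv
        d1_def[symmetric] d2_def[symmetric] J e1 e2)
qed

text \<open>The equation serves twice: solved for the Ricci tensor it exhibits a bilinear form, as
  the orthonormal trace requires, and at a maximum of \<open>f\<close> it bounds that form below by
  \<open>- lam\<close> times the metric on the diagonal.\<close>

lemma scalar_curvature_lower_bound:
  fixes AB :: "('p, 'b::euclidean_space) chart set"
  assumes M: "smooth_manifold X AB" "compact_space X" and g: "riemannian_metric AB g"
    and const: "constant_scalar_curvature AB g" and f: "smooth_function AB f"
    and eq: "\<And>c p u v. c \<in> AB \<Longrightarrow> p \<in> chart_dom c \<Longrightarrow>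
           ricci g c p u v + hessian g f c p u v + lam * g c p u v
           + mu * differential f c p u * differential f c p v = 0"
    and c: "c \<in> AB" and p: "p \<in> chart_dom c"
  shows "bilinear (ricci g c p)" "scalar_curvature g c p \<ge> - real DIM('b) * lam"
proof -
  have bil: "bilinear (ricci g c p)" if "c \<in> AB" "p \<in> chart_dom c" for c p
  proof -
    interpret metric_chart c g by (rule riemannian_metric_chart[OF M(1) g that(1)])
    have sm: "smooth_on (chart_map c ` chart_dom c) (f \<circ> chart_inv c)"
      using f that by (simp add: smooth_function_def)
    have "linear (differential f c p)"
      unfolding differential_def
      by (intro linear_chart_deriv smooth_chart_differentiable[OF sm] that)
    note d = linear_add[OF this] linear_scale[OF this]
    note b = bilinear_hessian[OF sm that(2)] inner_product_form.bilinear[OF form[OF that(2)]]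
    have ric: "ricci g c p = (\<lambda>u v. - hessian g f c p u v - lam * g c p u v
           - mu * differential f c p u * differential f c p v)"
    proof (intro ext)
      fix u v
      show "ricci g c p u v = - hessian g f c p u v - lam * g c p u v
           - mu * differential f c p u * differential f c p v"
        using eq[OF that, of u v] by linarith
    qed
    show ?thesis
      unfolding ric bilinear_def
      by (intro conjI allI linearI)
        (simp_all add: d b[THEN bilinear_ladd] b[THEN bilinear_radd]
          b[THEN bilinear_lmul] b[THEN bilinear_rmul] algebra_simps)
  qed
  then show "bilinear (ricci g c p)" using c p .
  have "p \<in> topspace X" using smooth_manifold_cover[OF M(1)] c p by blast
  have "compact (f ` topspace X)"
    using image_compactin[OF _ continuous_map_smooth_function[OF M(1) f]] M(2)
    by (simp add: compact_space_def)
  \<comment> \<open>The given point \<open>p\<close> makes the image nonempty, so the maximum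
    exists.\<close>
  with \<open>p \<in> topspace X\<close> obtain p0 where p0: "p0 \<in> topspace X" "\<And>q. q \<in> topspace X \<Longrightarrow> f q \<le> f p0"
    using compact_attains_sup[of "f ` topspace X"] by blast
  then obtain d where d: "d \<in> AB" "p0 \<in> chart_dom d" using smooth_manifold_cover[OF M(1)] by blast
  interpret metric_chart d g by (rule riemannian_metric_chart[OF M(1) g d(1)])
  have "chart_dom d \<subseteq> topspace X" using smooth_manifold_cover[OF M(1)] d by blast
  then have max: "q \<in> chart_dom d \<Longrightarrow> f q \<le> f p0" for q using p0 by blast
  have sm: "smooth_on (chart_map d ` chart_dom d) (f \<circ> chart_inv d)"
    using f d by (simp add: smooth_function_def)
  note mx = differential_zero_and_hessian_nonpos_at_max[OF sm d(2) max]
  interpret inner_product_form "g d p0" using form d(2) .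
  obtain E where E: "finite E" "\<And>w. w = (\<Sum>e\<in>E. g d p0 w e *\<^sub>R e)"
    using orthonormal_expansion by blast
  note tr = metric_trace_expansion[where g=g and c=d and p=p0 and E=E, OF inner_product_form_axioms E(2)]
  \<comment> \<open>Writing the dimension as the trace of the metric allows a comparison term by
    term over \<open>E\<close>.\<close>
  have "- real DIM('b) * lam = - lam * metric_trace g g d p0"
    by (subst metric_trace_scaled_metric[where g=g and c=d and p=p0 and T=g and k=1,
        OF inner_product_form_axioms]) simp_all
  also have "\<dots> = (\<Sum>e\<in>E. - lam * g d p0 e e)"
    by (subst tr[where T=g, OF bilinear]) (simp add: sum_distrib_left)
  also have "\<dots> \<le> (\<Sum>e\<in>E. ricci g d p0 e e)"
  proof (rule sum_mono)
    fix e
    \<comment> \<open>The term with \<open>mu\<close> vanishes together with the differential,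
      whatever the sign of \<open>mu\<close>.\<close>
    show "- lam * g d p0 e e \<le> ricci g d p0 e e"
      using eq[OF d, of e e] mx[of e] by simp
  qed
  also have "\<dots> = scalar_curvature g d p0"
    unfolding scalar_curvature_def by (subst tr[where T="ricci g", OF bil[OF d]]) (rule refl)
  \<comment> \<open>The maximum may lie outside the chart \<open>c\<close>; constancy carries the
    value over to \<open>p\<close>.\<close>
  also have "\<dots> = scalar_curvature g c p"
  proof -
    obtain k where "\<forall>c\<in>AB. \<forall>p\<in>chart_dom c. scalar_curvature g c p = k"
      using const unfolding constant_scalar_curvature_def by blast
    then show ?thesis using c p d by simp
  qed
  finally show "scalar_curvature g c p \<ge> - real DIM('b) * lam" .
qed

theorem proposition4p8:
  fixes XB :: "'p topology" and AB :: "('p, 'b::euclidean_space) chart set"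
    and gB :: "('p, 'b) tensor2" and f :: "'p \<Rightarrow> real"
    and XF :: "'q topology" and AF :: "('q, 'c::euclidean_space) chart set"
    and gF :: "('q, 'c) tensor2"
    and g :: "('p \<times> 'q, 'b \<times> 'c) tensor2" and \<xi> :: "('p \<times> 'q, 'b \<times> 'c) vector_field"
    and n m :: nat and lam mu :: real
  assumes "smooth_manifold XB AB" and "oriented_atlas AB" and "compact_space XB"
    and "n = DIM('b)"
    and "riemannian_metric AB gB" and "constant_scalar_curvature AB gB"
    and "smooth_function AB f"
    and "m = DIM('c)" and "m > 1"
    and "\<forall>c\<in>AB. \<forall>p\<in>chart_dom c. \<forall>u v.
           ricci gB c p u v + hessian gB f c p u v + lam * gB c p u v
           + mu * differential f c p u * differential f c p v = 0"
    and "smooth_manifold XF AF" and "riemannian_metric AF gF"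
    and "\<forall>c\<in>AF. \<forall>q\<in>chart_dom c. \<forall>u v. ricci gF c q u v = - lam * gF c q u v"
    and "g = product_metric AB gB AF gF"
    and "\<xi> = gradient g (f \<circ> fst)"
    and "gradient_eta_ricci_soliton (prod_atlas AB AF) g \<xi> lam mu"
  shows "\<forall>c \<in> prod_atlas AB AF. \<forall>z \<in> chart_dom c.
           scalar_curvature g c z \<ge> - real (n + m) * lam"
proof (intro ballI)
  fix c z assume "c \<in> prod_atlas AB AF" and z: "z \<in> chart_dom c"
  then obtain c1 c2 where c12: "c1 \<in> AB" "c2 \<in> AF"
    and c: "c = (chart_dom c1 \<times> chart_dom c2, map_prod (chart_map c1) (chart_map c2))"
    by (auto simp: prod_atlas_def)
  with z obtain p q where pq: "z = (p, q)" "p \<in> chart_dom c1" "q \<in> chart_dom c2" by auto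
  \<comment> \<open>Charts of the product atlas are products of charts, and in each of them the
    product metric has block form.\<close>
  interpret product_chart c1 gB c2 gF c g
    using product_metric_chart[OF assms(1,5) c12(1) assms(11,12) c12(2) c] assms(14) by simp
  interpret form: inner_product_form "gF c2 q" using F.form pq(3) .
  have ricF: "ricci gF c2 q u v = - lam * gF c2 q u v" for u v
    using assms(13) c12 pq by blast
  then have ricF': "ricci gF c2 q = (\<lambda>u v. - lam * gF c2 q u v)" by (intro ext)
  have "bilinear (ricci gF c2 q)"
    unfolding ricF' bilinear_def
    by (intro conjI allI linearI)
      (simp_all add: form.bilinear[THEN bilinear_ladd] form.bilinear[THEN bilinear_radd]
        form.bilinear[THEN bilinear_lmul] form.bilinear[THEN bilinear_rmul] algebra_simps)
  moreover have "scalar_curvature gF c2 q = - lam * m"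
    unfolding scalar_curvature_def assms(8)
    by (rule metric_trace_scaled_metric[where g=gF and c=c2 and p=q and T="ricci gF",
          OF form.inner_product_form_axioms ricF])
  moreover have "bilinear (ricci gB c1 p)" "scalar_curvature gB c1 p \<ge> - real n * lam"
    using scalar_curvature_lower_bound[OF assms(1,3,5,6,7) _ c12(1) pq(2), of lam mu] assms(4,10)
    by auto
  ultimately show "scalar_curvature g c z \<ge> - real (n + m) * lam"
    using scalar_curvature_product[OF pq(2,3)] pq(1) by (simp add: algebra_simps)
qed

end
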